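(* Let $A$ be a square complex matrix, $t>0$, and $N\ge 0$ an integer. Suppose that every eigenvalue $\lambda$ of $A$ satisfies $\operatorname{Im}(\lambda)\ge\lambda^*$ for some constant $\lambda^*>0$. Then all eigenvalues of $P_NA$ lie within the (closed) disk in $\mathbb{C}$ centered at $1$ with radius $\exp(-(N+1)t\lambda^* )$, where $$P_N:=-\mathrm{i}t\left(\sum_{n=0}^N\psi_0(\mathrm{i}tA)^n\right)\psi_1(\mathrm{i}tA).$$
   Context: The entire functions $\psi_l:\mathbb{C}\to\mathbb{C}$, $l\ge0$, are defined by $\psi_0(z)=\exp(z)$ and the recurrence $\psi_{l+1}(z)=\dfrac{\psi_l(z)-1/l!}{z}$ (extended analytically at $z=0$); in particular $\psi_1(z)=(e^z-1)/z$ with $\psi_1(0)=1$. For a square matrix $M$, $\psi_l(M)$ denotes the corresponding matrix function (given by the power series of $\psi_l$); thus $\psi_0(M)=\exp(M)$ and $t\,\psi_1(\mathrm{i}tA)=\int_0^t\exp(\mathrm{i}\tau A)\,d\tau$. *)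

theory Defs
  imports "HOL-Complex_Analysis.Complex_Analysis" "Jordan_Normal_Form.Spectral_Radius"
begin

text \<open>
  The singularity of the quotient at the origin is removable, so its limit there is the value
  of the analytic extension.
\<close>

primrec psi :: "nat \<Rightarrow> complex \<Rightarrow> complex" where
  "psi 0 = exp"
| "psi (Suc l) = (\<lambda>z. if z = 0 then Lim (at 0) (\<lambda>w. (psi l w - 1 / fact l) / w)
                       else (psi l z - 1 / fact l) / z)"

text \<open>
  The type of matrices carries no topology; convergence of the power series is entrywise.
  For the functions \<open>psi l\<close> the series always converges, see \<open>mat_fun_psi_sums\<close> below.
\<close>

definition mat_fun :: "(complex \<Rightarrow> complex) \<Rightarrow> complex mat \<Rightarrow> complex mat" where
  "mat_fun f M = mat (dim_row M) (dim_row M)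
     (\<lambda>(i, j). \<Sum>k. fps_nth (fps_expansion f 0) k * (M ^\<^sub>m k) $$ (i, j))"

definition P_mat :: "nat \<Rightarrow> real \<Rightarrow> complex mat \<Rightarrow> complex mat" where
  "P_mat N t A = (- \<i> * of_real t) \<cdot>\<^sub>m
     (finsum (ring_mat TYPE(complex) (dim_row A) ())
        (\<lambda>n. mat_fun (psi 0) ((\<i> * of_real t) \<cdot>\<^sub>m A) ^\<^sub>m n) {0..N}
      * mat_fun (psi 1) ((\<i> * of_real t) \<cdot>\<^sub>m A))"

lemma psi_sums: "(\<lambda>k. z ^ k / fact (k + l)) sums psi l z"
proof (induction l arbitrary: z)
  case 0
  show ?case using exp_converges[of z] by (simp add: scaleR_conv_of_real field_simps)
next
  case (Suc l)
  have *: "(\<lambda>k. w ^ k / fact (k + Suc l)) sums ((psi l w - 1 / fact l) / w)"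
    if w: "w \<noteq> 0" for w
  proof -
    have "(\<lambda>k. w ^ Suc k / fact (Suc k + l)) sums (psi l w - 1 / fact l)"
      using Suc.IH[of w] by (subst sums_Suc_iff) simp
    then have "(\<lambda>k. w ^ Suc k / fact (Suc k + l) / w) sums ((psi l w - 1 / fact l) / w)"
      by (rule sums_divide)
    moreover have "w ^ Suc k / fact (Suc k + l) / w = w ^ k / fact (k + Suc l)" for k
      using w by simp
    ultimately show ?thesis by simp
  qed
  show ?case
  proof (cases "z = 0")
    case False
    with *[of z] show ?thesis by simp
  next
    case True
    have "((\<lambda>w. (psi l w - 1 / fact l) / w) \<longlongrightarrow> 1 / fact (0 + Suc l)) (at 0)"
      by (rule powser_limit_0_strong[where s = 1]) (use * in auto)
    then have "psi (Suc l) z = 1 / fact (Suc l)"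
      using True by (simp add: tendsto_Lim)
    moreover have "(\<lambda>k. z ^ k / fact (k + Suc l)) sums (1 / fact (Suc l))"
      using powser_sums_zero[of "\<lambda>k. 1 / fact (k + Suc l) :: complex"] True by simp
    ultimately show ?thesis by simp
  qed
qed

lemma psi_at_0: "psi l 0 = 1 / fact l"
  using sums_unique2[OF psi_sums[of 0 l]]
    powser_sums_zero[of "\<lambda>k. 1 / fact (k + l) :: complex"] by simp

lemma psi_fps_conv_radius:
  "fps_conv_radius (Abs_fps (\<lambda>k. 1 / fact (k + l) :: complex)) = \<infinity>"
  unfolding fps_conv_radius_def
proof (intro conv_radius_inftyI'')
  fix z :: complex
  show "summable (\<lambda>k. fps_nth (Abs_fps (\<lambda>k. 1 / fact (k + l))) k * z ^ k)"
    using psi_sums[of z l] by (simp add: sums_iff)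
qed

lemma psi_eq_eval_fps: "psi l = eval_fps (Abs_fps (\<lambda>k. 1 / fact (k + l)))"
  by (rule ext) (use sums_unique[OF psi_sums] in \<open>simp add: eval_fps_def\<close>)

lemma psi_holomorphic: "psi l holomorphic_on S"
  unfolding psi_eq_eval_fps
  by (rule holomorphic_on_eval_fps) (simp add: psi_fps_conv_radius)

lemma fps_nth_psi: "fps_nth (fps_expansion (psi l) 0) k = 1 / fact (k + l)"
proof -
  have "psi l has_fps_expansion Abs_fps (\<lambda>k. 1 / fact (k + l))"
    by (simp add: has_fps_expansion_def psi_fps_conv_radius psi_eq_eval_fps)
  from fps_expansion_eqI[OF this] show ?thesis by simp
qed

lemma pow_mat_entry_bound:
  fixes M :: "complex mat"
  assumes M: "M \<in> carrier_mat m m"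
  obtains c where "c \<ge> 0" "\<And>k i j. i < m \<Longrightarrow> j < m \<Longrightarrow> norm ((M ^\<^sub>m k) $$ (i, j)) \<le> c ^ k"
proof -
  define b where "b = (\<Sum>i<m. \<Sum>j<m. norm (M $$ (i, j)))"
  have b0: "b \<ge> 0" unfolding b_def by (intro sum_nonneg) auto
  have b: "norm (M $$ (i, j)) \<le> b" if "i < m" "j < m" for i j
  proof -
    have "norm (M $$ (i, j)) \<le> (\<Sum>j<m. norm (M $$ (i, j)))"
      using that by (intro member_le_sum) auto
    also have "\<dots> \<le> b" unfolding b_def
      using that by (intro member_le_sum[of i "{..<m}" "\<lambda>i. \<Sum>j<m. norm (M $$ (i, j))"])
        (auto intro: sum_nonneg)
    finally show ?thesis .
  qed
  have "norm ((M ^\<^sub>m k) $$ (i, j)) \<le> (real m * b) ^ k" if "i < m" "j < m" for k i j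
    using that
  proof (induction k arbitrary: i j)
    case 0
    then show ?case using M by simp
  next
    case (Suc k)
    have "(M ^\<^sub>m Suc k) $$ (i, j) = (\<Sum>r<m. (M ^\<^sub>m k) $$ (i, r) * M $$ (r, j))"
      using M Suc.prems by (simp add: scalar_prod_def atLeast0LessThan)
    also have "norm \<dots> \<le> (\<Sum>r<m. (real m * b) ^ k * b)"
    proof (rule sum_norm_le)
      fix r assume "r \<in> {..<m}"
      then show "norm ((M ^\<^sub>m k) $$ (i, r) * M $$ (r, j)) \<le> (real m * b) ^ k * b"
        unfolding norm_mult using Suc b b0 by (intro mult_mono) auto
    qed
    also have "\<dots> = (real m * b) ^ Suc k" by simp
    finally show ?case .
  qed
  with b0 show ?thesis by (intro that[of "real m * b"]) auto
qed

lemma mat_fun_psi_sums: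
  assumes M: "M \<in> carrier_mat m m" and "i < m" "j < m"
  shows "(\<lambda>k. (M ^\<^sub>m k) $$ (i, j) / fact (k + l)) sums (mat_fun (psi l) M $$ (i, j))"
proof -
  obtain c where c: "c \<ge> 0" "\<And>k. norm ((M ^\<^sub>m k) $$ (i, j)) \<le> c ^ k"
    using pow_mat_entry_bound[OF M] assms by metis
  have "summable (\<lambda>k. (M ^\<^sub>m k) $$ (i, j) / fact (k + l))"
  proof (rule summable_comparison_test')
    show "summable (\<lambda>k. c ^ k / fact k)"
      using summable_exp[of c] by (simp add: field_simps)
    show "norm ((M ^\<^sub>m k) $$ (i, j) / fact (k + l)) \<le> c ^ k / fact k" for k
      using c fact_mono[of k "k + l", where ?'a = real] by (simp add: norm_divide frac_le)
  qed
  then show ?thesis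
    using assms by (simp add: mat_fun_def fps_nth_psi summable_sums)
qed

end

theory Submission
  imports Defs
begin

text \<open>
  Write \<open>X = i t A\<close> and \<open>E = exp X\<close>. The recurrence for the functions \<open>psi l\<close> holds for
  matrices as well and gives \<open>psi 1 X * X = E - 1\<close> (\<open>mat_fun_psi_Suc_mult\<close>). Hence \<open>P\<^sub>N A\<close> is
  minus the geometric sum \<open>1 + E + \<dots> + E^N\<close> times \<open>E - 1\<close>, and it collapses to
  \<open>1 - E^(N+1)\<close> (\<open>P_mat_mult\<close>). In other words, \<open>P\<^sub>N\<close> approximates the inverse of \<open>A\<close> with
  the residual \<open>E^(N+1)\<close>.

  It remains to see that every eigenvalue of \<open>E^(N+1)\<close> is of the form
  \<open>exp (i t lam)^(N+1)\<close> for an eigenvalue \<open>lam\<close> of \<open>A\<close>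
  (\<open>eigenvalue_mat_fun_psi_pow\<close>): such a number has modulus
  \<open>exp (- (N+1) t Im lam)\<close>, which is at most the required radius. For this the matrix is
  brought to upper triangular form. Conjugation commutes with the power series and with powers,
  and on upper triangular matrices both act on each diagonal entry separately; the
  diagonal entries are the eigenvalues.
\<close>

section \<open>Eigenvalues and triangular matrices\<close>

lemma mult_mat_entry:
  fixes A B :: "'a :: semiring_0 mat"
  assumes "A \<in> carrier_mat n n" "B \<in> carrier_mat n n" "i < n" "j < n"
  shows "(A * B) $$ (i, j) = (\<Sum>k<n. A $$ (i, k) * B $$ (k, j))"
  using assms by (simp add: scalar_prod_def atLeast0LessThan)

text \<open>
  In the sum for the entry \<open>(i, j)\<close> of the product, a nonzero term needs \<open>i \<le> k \<le> j\<close>: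
  no such \<open>k\<close> exists below the diagonal, and only \<open>k = i\<close> on it.
\<close>

lemma upper_triangular_mult:
  fixes A B :: "'a :: comm_semiring_0 mat"
  assumes "A \<in> carrier_mat n n" "B \<in> carrier_mat n n" "upper_triangular A" "upper_triangular B"
  shows "upper_triangular (A * B)"
    and "i < n \<Longrightarrow> (A * B) $$ (i, i) = A $$ (i, i) * B $$ (i, i)"
proof -
  have zero: "A $$ (i, k) * B $$ (k, j) = 0" if "i < n" "j < n" "k < n" "k < i \<or> j < k" for i j k
    using that assms(1,2) upper_triangularD[OF assms(3), of k i] upper_triangularD[OF assms(4), of j k]
    by auto
  show "upper_triangular (A * B)"
  proof (rule upper_triangularI)
    fix i j assume "j < i" "i < dim_row (A * B)"
    then have ij: "i < n" "j < n" and k: "k < i \<or> j < k" for k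
      using assms(1) by auto
    have "(A * B) $$ (i, j) = (\<Sum>k <n. A $$ (i, k) * B $$ (k, j))"
      using mult_mat_entry[OF assms(1,2) ij] .
    also have "\<dots> = 0"
      using zero[OF ij _ k] by (intro sum.neutral) simp
    finally show "(A * B) $$ (i, j) = 0" .
  qed
  show "(A * B) $$ (i, i) = A $$ (i, i) * B $$ (i, i)" if i: "i < n"
  proof -
    have "(A * B) $$ (i, i) = (\<Sum>k <n. A $$ (i, k) * B $$ (k, i))"
      using mult_mat_entry[OF assms(1,2) i i] .
    also have "\<dots> = (\<Sum>k <n. if k = i then A $$ (i, i) * B $$ (i, i) else 0)"
    proof (rule sum.cong)
      fix k assume "k \<in> {..<n}"
      then show "A $$ (i, k) * B $$ (k, i) = (if k = i then A $$ (i, i) * B $$ (i, i) else 0)"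
        using zero[of i i k] i by (cases "k = i") (auto simp: nat_neq_iff)
    qed simp
    finally show ?thesis using i by simp
  qed
qed

lemma upper_triangular_pow:
  fixes A :: "'a :: comm_semiring_1 mat"
  assumes A: "A \<in> carrier_mat n n" and ut: "upper_triangular A"
  shows "upper_triangular (A ^\<^sub>m k)"
    and "i < n \<Longrightarrow> (A ^\<^sub>m k) $$ (i, i) = (A $$ (i, i)) ^ k"
proof -
  have "upper_triangular (A ^\<^sub>m k) \<and> (i < n \<longrightarrow> (A ^\<^sub>m k) $$ (i, i) = (A $$ (i, i)) ^ k)"
  proof (induction k)
    case 0
    show ?case using A by auto
  next
    case (Suc k)
    then have IH: "upper_triangular (A ^\<^sub>m k)" "i < n \<Longrightarrow> (A ^\<^sub>m k) $$ (i, i) = (A $$ (i, i)) ^ k"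
      by blast+
    note step = upper_triangular_mult[OF pow_carrier_mat[OF A] A IH(1) ut]
    show ?case
      using step(1) by (simp add: step(2) IH(2) mult.commute)
  qed
  then show "upper_triangular (A ^\<^sub>m k)" "i < n \<Longrightarrow> (A ^\<^sub>m k) $$ (i, i) = (A $$ (i, i)) ^ k"
    by auto
qed

lemma eigenvalue_upper_triangular_iff:
  fixes U :: "'a :: field mat"
  assumes U: "U \<in> carrier_mat n n" and ut: "upper_triangular U"
  shows "eigenvalue U x \<longleftrightarrow> (\<exists>i<n. x = U $$ (i, i))"
  using U unfolding eigenvalue_root_char_poly[OF U] char_poly_upper_triangular[OF U ut]
  by (auto simp: poly_prod_list prod_list_zero_iff diag_mat_def)

lemma eigenvalue_similar:
  fixes A B :: "'a :: field mat"
  assumes "similar_mat_wit A B P Q"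
  shows "eigenvalue A x \<longleftrightarrow> eigenvalue B x"
proof -
  have "similar_mat A B" using assms unfolding similar_mat_def by blast
  moreover have "A \<in> carrier_mat (dim_row A) (dim_row A)" "B \<in> carrier_mat (dim_row A) (dim_row A)"
    by (rule similar_mat_witD(4,5)[OF refl assms])+
  ultimately show ?thesis
    using eigenvalue_root_char_poly char_poly_similar by metis
qed

lemma eigenvalue_one_minus:
  fixes T :: "'a :: comm_ring_1 mat"
  assumes T: "T \<in> carrier_mat n n" and ev: "eigenvalue (1\<^sub>m n - T) x"
  shows "eigenvalue T (1 - x)"
proof -
  from ev obtain v where v: "v \<in> carrier_vec n" "v \<noteq> 0\<^sub>v n" and eq: "(1\<^sub>m n - T) *\<^sub>v v = x \<cdot>\<^sub>v v"
    using T by (auto simp: eigenvalue_def eigenvector_def)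
  have "T *\<^sub>v v = v - (v - T *\<^sub>v v)"
    using T v by (intro eq_vecI) auto
  also have "v - T *\<^sub>v v = x \<cdot>\<^sub>v v"
    using eq minus_mult_distrib_mat_vec[OF one_carrier_mat T v(1)] v by simp
  also have "v - x \<cdot>\<^sub>v v = (1 - x) \<cdot>\<^sub>v v"
    using v by (intro eq_vecI) (auto simp: algebra_simps)
  finally have "T *\<^sub>v v = (1 - x) \<cdot>\<^sub>v v" .
  then show ?thesis using T v by (auto simp: eigenvalue_def eigenvector_def)
qed

lemma eigenvalue_smultD:
  fixes A :: "'a :: field mat"
  assumes A: "A \<in> carrier_mat n n" and c: "c \<noteq> 0" and ev: "eigenvalue (c \<cdot>\<^sub>m A) x"
  shows "eigenvalue A (x / c)"
proof -
  from ev obtain v where v: "v \<in> carrier_vec n" "v \<noteq> 0\<^sub>v n" and eq: "(c \<cdot>\<^sub>m A) *\<^sub>v v = x \<cdot>\<^sub>v v"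
    using A by (auto simp: eigenvalue_def eigenvector_def)
  have "(c \<cdot>\<^sub>m A) *\<^sub>v v = c \<cdot>\<^sub>v (A *\<^sub>v v)"
    using A v(1) by (intro eq_vecI) auto
  then have "c \<cdot>\<^sub>v (A *\<^sub>v v) = x \<cdot>\<^sub>v v" using eq by simp
  then have "(1 / c) \<cdot>\<^sub>v (c \<cdot>\<^sub>v (A *\<^sub>v v)) = (1 / c) \<cdot>\<^sub>v (x \<cdot>\<^sub>v v)" by simp
  then have "A *\<^sub>v v = (x / c) \<cdot>\<^sub>v v"
    using c by (simp add: smult_smult_assoc)
  then show ?thesis using A v by (auto simp: eigenvalue_def eigenvector_def)
qed

section \<open>The functions \<open>psi l\<close> of a matrix\<close>

lemma mat_fun_carrier [simp]: "M \<in> carrier_mat n n \<Longrightarrow> mat_fun f M \<in> carrier_mat n n"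
  by (simp add: mat_fun_def)

text \<open>
  Entrywise convergence makes this a matter of single entries: below the diagonal every term of
  the series is zero, and on the diagonal it is the scalar series of \<open>psi l\<close>.
\<close>

lemma mat_fun_psi_upper_triangular:
  assumes U: "U \<in> carrier_mat n n" and ut: "upper_triangular U"
  shows "upper_triangular (mat_fun (psi l) U)"
    and "i < n \<Longrightarrow> mat_fun (psi l) U $$ (i, i) = psi l (U $$ (i, i))"
proof -
  show "upper_triangular (mat_fun (psi l) U)"
  proof (rule upper_triangularI)
    fix i j assume ji: "j < i" and "i < dim_row (mat_fun (psi l) U)"
    then have i: "i < n" and j: "j < n" using U by (auto simp: mat_fun_def)
    have "(U ^\<^sub>m k) $$ (i, j) = 0" for k
      using upper_triangularD[OF upper_triangular_pow(1)[OF U ut] ji] i U by auto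
    then show "mat_fun (psi l) U $$ (i, j) = 0"
      using mat_fun_psi_sums[OF U i j, of l] sums_zero sums_unique2 by simp blast
  qed
  show "mat_fun (psi l) U $$ (i, i) = psi l (U $$ (i, i))" if i: "i < n"
    using mat_fun_psi_sums[OF U i i, of l] psi_sums[of "U $$ (i, i)" l]
    by (simp add: upper_triangular_pow(2)[OF U ut i] sums_unique2)
qed

lemma triple_product_entry:
  fixes P B Q :: "'a :: comm_semiring_0 mat"
  assumes "P \<in> carrier_mat n n" "B \<in> carrier_mat n n" "Q \<in> carrier_mat n n" "i < n" "j < n"
  shows "(P * B * Q) $$ (i, j) = (\<Sum>s<n. \<Sum>r<n. P $$ (i, r) * B $$ (r, s) * Q $$ (s, j))"
  using assms
  by (simp add: scalar_prod_def sum_distrib_right atLeast0LessThan del: assoc_mult_mat)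

text \<open>
  Conjugation by \<open>P\<close> and \<open>Q\<close> turns each power of \<open>B\<close> into the same power of \<open>A\<close>. Each entry
  of a conjugate is a finite linear combination of entries, so conjugation may be interchanged
  with the infinite sum.
\<close>

lemma mat_fun_psi_similar:
  assumes sim: "similar_mat_wit A B P Q"
  shows "similar_mat_wit (mat_fun (psi l) A) (mat_fun (psi l) B) P Q"
proof -
  define n where "n = dim_row A"
  note D = similar_mat_witD[OF n_def sim]
  have "mat_fun (psi l) A = P * mat_fun (psi l) B * Q"
  proof (rule eq_matI)
    fix i j
    assume "i < dim_row (P * mat_fun (psi l) B * Q)" "j < dim_col (P * mat_fun (psi l) B * Q)"
    then have i: "i < n" and j: "j < n" using D by auto
    have "(\<lambda>k. \<Sum>s<n. \<Sum>r<n. P $$ (i, r) * ((B ^\<^sub>m k) $$ (r, s) / fact (k + l)) * Q $$ (s, j))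
        sums (\<Sum>s<n. \<Sum>r<n. P $$ (i, r) * mat_fun (psi l) B $$ (r, s) * Q $$ (s, j))"
      by (intro sums_sum sums_mult2 sums_mult mat_fun_psi_sums[OF D(5)]) auto
    moreover have "(\<Sum>s<n. \<Sum>r<n. P $$ (i, r) * ((B ^\<^sub>m k) $$ (r, s) / fact (k + l)) * Q $$ (s, j))
        = (A ^\<^sub>m k) $$ (i, j) / fact (k + l)" for k
      unfolding similar_mat_wit_pow_id[OF sim]
        triple_product_entry[OF D(6) pow_carrier_mat[OF D(5)] D(7) i j]
      by (simp add: sum_divide_distrib)
    ultimately show "mat_fun (psi l) A $$ (i, j) = (P * mat_fun (psi l) B * Q) $$ (i, j)"
      using mat_fun_psi_sums[OF D(4) i j, of l]
      by (simp add: triple_product_entry[OF D(6) mat_fun_carrier[OF D(5)] D(7) i j] sums_unique2)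
  qed (use D in \<open>auto simp: mat_fun_def\<close>)
  then show ?thesis using D by (intro similar_mat_witI[of P Q n]) auto
qed

text \<open>
  This is one inclusion of the spectral mapping theorem for \<open>psi l ^ k\<close>. A Schur form \<open>U\<close> of
  \<open>M\<close> suffices: the diagonal of \<open>U\<close> consists of eigenvalues of \<open>M\<close>, and
  the diagonal of the triangular matrix obtained from \<open>U\<close> consists of their images.
\<close>

lemma eigenvalue_mat_fun_psi_pow:
  assumes M: "M \<in> carrier_mat n n" and ev: "eigenvalue (mat_fun (psi l) M ^\<^sub>m k) x"
  obtains y where "eigenvalue M y" "x = psi l y ^ k"
proof -
  from char_poly_factorized[OF M] obtain es where "char_poly M = (\<Prod>e\<leftarrow>es. [:- e, 1:])"
    by blast
  from schur_decomposition_exists[OF M this] obtain U P Q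
    where U: "U \<in> carrier_mat n n" and ut: "upper_triangular U" and sim: "similar_mat_wit M U P Q"
    unfolding similar_mat_def by blast
  let ?F = "mat_fun (psi l) U"
  note F = mat_fun_psi_upper_triangular[OF U ut, where l = l]
  have "eigenvalue (?F ^\<^sub>m k) x"
    using ev eigenvalue_similar[OF similar_mat_wit_pow[OF mat_fun_psi_similar[OF sim]]] by blast
  then obtain i where i: "i < n" and x: "x = (?F ^\<^sub>m k) $$ (i, i)"
    using eigenvalue_upper_triangular_iff[OF pow_carrier_mat upper_triangular_pow(1)[OF _ F(1)]] U
    by (metis mat_fun_carrier)
  have "x = psi l (U $$ (i, i)) ^ k"
    using x upper_triangular_pow(2)[OF mat_fun_carrier[OF U] F(1) i] F(2)[OF i] by simp
  moreover have "eigenvalue M (U $$ (i, i))"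
    using eigenvalue_similar[OF sim] eigenvalue_upper_triangular_iff[OF U ut] i by blast
  ultimately show ?thesis using that by blast
qed

text \<open>
  The recurrence that defines \<open>psi (Suc l)\<close>, without the division. Multiplication by \<open>M\<close>
  shifts the power series by one place, so that only the constant term of the series
  of \<open>psi l\<close> is missing.
\<close>

lemma mat_fun_psi_Suc_mult:
  assumes M: "M \<in> carrier_mat n n"
  shows "mat_fun (psi (Suc l)) M * M = mat_fun (psi l) M - (1 / fact l) \<cdot>\<^sub>m 1\<^sub>m n"
proof (rule eq_matI)
  fix i j
  assume "i < dim_row (mat_fun (psi l) M - (1 / fact l) \<cdot>\<^sub>m 1\<^sub>m n)"
    "j < dim_col (mat_fun (psi l) M - (1 / fact l) \<cdot>\<^sub>m 1\<^sub>m n)"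
  then have i: "i < n" and j: "j < n" by auto
  have "(\<lambda>k. \<Sum>r<n. (M ^\<^sub>m k) $$ (i, r) / fact (k + Suc l) * M $$ (r, j))
      sums (\<Sum>r<n. mat_fun (psi (Suc l)) M $$ (i, r) * M $$ (r, j))"
    by (intro sums_sum sums_mult2 mat_fun_psi_sums[OF M i]) auto
  moreover have "(\<Sum>r<n. (M ^\<^sub>m k) $$ (i, r) / fact (k + Suc l) * M $$ (r, j))
      = (M ^\<^sub>m Suc k) $$ (i, j) / fact (Suc k + l)" for k
    by (simp add: mult_mat_entry[OF pow_carrier_mat[OF M] M i j] sum_divide_distrib)
  moreover have "(\<Sum>r<n. mat_fun (psi (Suc l)) M $$ (i, r) * M $$ (r, j))
      = (mat_fun (psi (Suc l)) M * M) $$ (i, j)"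
    by (simp only: mult_mat_entry[OF mat_fun_carrier[OF M] M i j])
  ultimately have "(\<lambda>k. (M ^\<^sub>m Suc k) $$ (i, j) / fact (Suc k + l))
      sums (mat_fun (psi (Suc l)) M * M) $$ (i, j)"
    by (simp del: pow_mat.simps psi.simps)
  moreover have "(\<lambda>k. (M ^\<^sub>m Suc k) $$ (i, j) / fact (Suc k + l))
      sums (mat_fun (psi l) M $$ (i, j) - (M ^\<^sub>m 0) $$ (i, j) / fact (0 + l))"
    using mat_fun_psi_sums[OF M i j, of l] by (subst sums_Suc_iff) (simp del: pow_mat.simps)
  ultimately have "(mat_fun (psi (Suc l)) M * M) $$ (i, j)
      = mat_fun (psi l) M $$ (i, j) - (M ^\<^sub>m 0) $$ (i, j) / fact (0 + l)"
    by (rule sums_unique2)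
  then show "(mat_fun (psi (Suc l)) M * M) $$ (i, j)
      = (mat_fun (psi l) M - (1 / fact l) \<cdot>\<^sub>m 1\<^sub>m n) $$ (i, j)"
    using M i j by simp
qed (use M in \<open>auto simp: mat_fun_def\<close>)

section \<open>The geometric sum and the residual of \<open>P_mat\<close>\<close>

lemma mat_diff_telescope:
  fixes A B C :: "'a :: ring mat"
  assumes "A \<in> carrier_mat n n" "B \<in> carrier_mat n n" "C \<in> carrier_mat n n"
  shows "(A - B) + (B - C) = A - C"
  using assms by (intro eq_matI) auto

lemma uminus_smult_diff_mat:
  fixes A B :: "'a :: ring_1 mat"
  assumes "A \<in> carrier_mat n n" "B \<in> carrier_mat n n"
  shows "(- 1) \<cdot>\<^sub>m (A - B) = B - A"
  using assms by (intro eq_matI) auto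

lemma geometric_sum_mat:
  fixes E :: "'a :: comm_ring_1 mat"
  assumes E: "E \<in> carrier_mat n n"
  defines "S \<equiv> \<lambda>N. finsum (ring_mat TYPE('a) n ()) (\<lambda>k. E ^\<^sub>m k) {0..N}"
  shows "S N \<in> carrier_mat n n" and "S N * (E - 1\<^sub>m n) = E ^\<^sub>m Suc N - 1\<^sub>m n"
proof -
  interpret R: ring "ring_mat TYPE('a) n ()" by (rule ring_mat)
  have fn: "(\<lambda>k. E ^\<^sub>m k) \<in> I \<rightarrow> carrier (ring_mat TYPE('a) n ())" for I
    using pow_carrier_mat[OF E] by (simp add: ring_mat_simps)
  have car: "S N \<in> carrier_mat n n" for N
    using R.finsum_closed[OF fn, of "{0..N}"] by (simp add: S_def ring_mat_simps)
  then show "S N \<in> carrier_mat n n" .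
  have EI: "E - 1\<^sub>m n \<in> carrier_mat n n"
    using minus_carrier_mat[OF one_carrier_mat] .
  have step: "E ^\<^sub>m k * (E - 1\<^sub>m n) = E ^\<^sub>m Suc k - E ^\<^sub>m k" for k
    using mult_minus_distrib_mat[OF pow_carrier_mat[OF E, of k] E one_carrier_mat] E by simp
  show "S N * (E - 1\<^sub>m n) = E ^\<^sub>m Suc N - 1\<^sub>m n"
  proof (induction N)
    case 0
    have "S 0 = 1\<^sub>m n"
      using R.finsum_0[OF fn] E by (simp add: S_def)
    then show ?case using E by simp
  next
    case (Suc N)
    have "S (Suc N) = E ^\<^sub>m Suc N + S N"
      using R.finsum_Suc[OF fn, of N] by (simp add: S_def atMost_atLeast0 ring_mat_simps)
    then have "S (Suc N) * (E - 1\<^sub>m n) = (E ^\<^sub>m Suc (Suc N) - E ^\<^sub>m Suc N) + (E ^\<^sub>m Suc N - 1\<^sub>m n)"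
      using add_mult_distrib_mat[OF pow_carrier_mat[OF E] car EI, of "Suc N" N]
      unfolding Suc step by simp
    also have "\<dots> = E ^\<^sub>m Suc (Suc N) - 1\<^sub>m n"
      by (rule mat_diff_telescope[OF pow_carrier_mat[OF E] pow_carrier_mat[OF E] one_carrier_mat])
    finally show ?case .
  qed
qed

text \<open>
  The factor \<open>i t\<close> is moved onto \<open>A\<close>; then \<open>psi 1 X\<close> meets \<open>X = i t A\<close>, their product is
  \<open>exp X - 1\<close>, and the geometric sum telescopes.
\<close>

lemma P_mat_mult:
  assumes A: "A \<in> carrier_mat m m"
  shows "P_mat N t A * A = 1\<^sub>m m - mat_fun (psi 0) ((\<i> * of_real t) \<cdot>\<^sub>m A) ^\<^sub>m Suc N"
proof -
  define c where "c = \<i> * complex_of_real t"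
  define X where "X = c \<cdot>\<^sub>m A"
  define E where "E = mat_fun (psi 0) X"
  define F where "F = mat_fun (psi 1) X"
  define S where "S = finsum (ring_mat TYPE(complex) m ()) (\<lambda>k. E ^\<^sub>m k) {0..N}"
  have X: "X \<in> carrier_mat m m" using A by (simp add: X_def)
  have E: "E \<in> carrier_mat m m" and F: "F \<in> carrier_mat m m" using X by (auto simp: E_def F_def)
  note S = geometric_sum_mat[OF E, of N, folded S_def]
  have SF: "S * F \<in> carrier_mat m m" using S(1) F by simp
  have "P_mat N t A = - c \<cdot>\<^sub>m (S * F)"
    using A by (simp add: P_mat_def S_def F_def E_def X_def c_def)
  then have "P_mat N t A * A = - c \<cdot>\<^sub>m (S * F * A)"
    using mult_smult_assoc_mat[OF SF A] by simp
  also have "\<dots> = (- 1) \<cdot>\<^sub>m (c \<cdot>\<^sub>m (S * F * A))"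
    by (intro eq_matI) auto
  also have "c \<cdot>\<^sub>m (S * F * A) = S * F * X"
    unfolding X_def using mult_smult_distrib[OF SF A] by simp
  also have "\<dots> = S * (F * X)"
    using assoc_mult_mat[OF S(1) F X] .
  also have "F * X = E - 1\<^sub>m m"
  proof -
    have "(1 / fact 0 :: complex) \<cdot>\<^sub>m 1\<^sub>m m = 1\<^sub>m m" by (intro eq_matI) auto
    then show ?thesis
      using mat_fun_psi_Suc_mult[OF X, of 0] by (simp only: E_def F_def One_nat_def)
  qed
  also have "S * (E - 1\<^sub>m m) = E ^\<^sub>m Suc N - 1\<^sub>m m" by (rule S(2))
  also have "(- 1) \<cdot>\<^sub>m (E ^\<^sub>m Suc N - 1\<^sub>m m) = 1\<^sub>m m - E ^\<^sub>m Suc N"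
    by (rule uminus_smult_diff_mat[OF pow_carrier_mat[OF E] one_carrier_mat])
  finally show ?thesis by (simp add: E_def X_def c_def)
qed

section \<open>The disk containing the eigenvalues\<close>

theorem theorem3p1:
  fixes A :: "complex mat" and m N :: nat and t lstar :: real
  assumes "A \<in> carrier_mat m m"
    and "t > 0"
    and "lstar > 0"
    and "\<And>l. eigenvalue A l \<Longrightarrow> Im l \<ge> lstar"
  shows "\<forall>mu. eigenvalue (P_mat N t A * A) mu \<longrightarrow>
           mu \<in> cball 1 (exp (- (real N + 1) * t * lstar))"
proof (intro allI impI)
  fix mu assume ev: "eigenvalue (P_mat N t A * A) mu"
  define c where "c = \<i> * complex_of_real t"
  have c: "c \<noteq> 0" using assms(2) by (simp add: c_def)
  have X: "c \<cdot>\<^sub>m A \<in> carrier_mat m m" using assms(1) by simp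
  have "eigenvalue (mat_fun (psi 0) (c \<cdot>\<^sub>m A) ^\<^sub>m Suc N) (1 - mu)"
    using ev unfolding P_mat_mult[OF assms(1)] c_def[symmetric]
    by (rule eigenvalue_one_minus[OF pow_carrier_mat[OF mat_fun_carrier[OF X]]])
  then obtain y where y: "eigenvalue (c \<cdot>\<^sub>m A) y" and mu: "1 - mu = psi 0 y ^ Suc N"
    by (rule eigenvalue_mat_fun_psi_pow[OF X])
  define w where "w = y / c"
  \<comment> \<open>Multiplication by \<open>i t\<close> turns the lower bound on imaginary parts into an upper bound on
    real parts, and the modulus of \<open>exp y\<close> depends on the real part alone.\<close>
  have "lstar \<le> Im w"
    unfolding w_def using assms(4) eigenvalue_smultD[OF assms(1) c y] by blast
  then have "t * lstar \<le> t * Im w" using assms(2) by simp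
  moreover have "y = c * w" using c by (simp add: w_def)
  then have "Re y = - t * Im w" by (simp add: c_def)
  ultimately have Re: "Re y \<le> - t * lstar" by simp
  have "norm (1 - mu) = exp (Re y) ^ Suc N"
    unfolding mu by (simp add: norm_power norm_mult)
  also have "\<dots> = exp ((real N + 1) * Re y)"
    by (metis exp_of_nat_mult of_nat_Suc add.commute)
  also have "\<dots> \<le> exp (- (real N + 1) * t * lstar)"
    using mult_left_mono[OF Re, of "real N + 1"] by (simp add: algebra_simps)
  finally show "mu \<in> cball 1 (exp (- (real N + 1) * t * lstar))"
    by (simp add: dist_norm)
qed

end
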